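(* Let $x\in\{0,1\}^{\mathbb Z}$ have finite support. Then $F^t(x)_0=0$ for all $t\ge 0$ if and only if $x=0$ (the zero configuration). Moreover, if $x\ne 0$ has finite support, then no column of its orbit is eventually zero: there do not exist $i\in\mathbb Z$ and $T\ge 0$ such that $F^t(x)_i=0$ for all $t\ge T$.
   Context: Rule 30 is the map $F:\{0,1\}^{\mathbb Z}\to\{0,1\}^{\mathbb Z}$ given by $F(x)_i=x_{i-1}\oplus(x_i\lor x_{i+1})$, where $\oplus$ is addition modulo $2$ and $\lor$ is Boolean disjunction. $F^t$ is the $t$-fold iterate, with $F^0(x)=x$. A configuration $x$ has finite support if $\{i\in\mathbb Z:x_i=1\}$ is finite. Column $i$ of the orbit of $x$ is the sequence $(F^t(x)_i)_{t\ge 0}$. *)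

theory Defs
  imports "HOL-Library.Z2"
begin

text \<open>
  The alphabet is the two-element field \<^typ>\<open>bit\<close>: its addition is addition modulo 2,
  and its bitwise \<open>OR\<close> is Boolean disjunction.
\<close>

unbundle bit_operations_syntax

type_synonym configuration = "int \<Rightarrow> bit"

definition rule30 :: "configuration \<Rightarrow> configuration" where
  "rule30 x = (\<lambda>i. x (i - 1) + (x i OR x (i + 1)))"

definition zero_configuration :: configuration where
  "zero_configuration = (\<lambda>_. 0)"

definition finite_support :: "configuration \<Rightarrow> bool" where
  "finite_support x \<longleftrightarrow> finite {i. x i = 1}"

definition column :: "configuration \<Rightarrow> int \<Rightarrow> nat \<Rightarrow> bit" where
  "column x i = (\<lambda>t. (rule30 ^^ t) x i)"

end

theory Submission
  imports Defs
begin

text \<open>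
  Solving the local rule for its left argument shows that any two adjacent columns determine
  every column to their left (\<open>column_left\<close>); a column is computed from the two on its right,
  at the present and the next time step, so being constant from time \<open>T\<close> on spreads leftwards
  with the \<^emph>\<open>same\<close> \<open>T\<close> (\<open>columns_constant_left\<close>).

  A single column that vanishes from some time on already gives two adjacent eventually
  constant columns: next to a zero column on its left, a cell that is 1 stays 1, so the
  column on the right is eventually constant as well (\<open>column_right_of_zero_constant\<close>).

  On the other hand, the leftmost 1 of a nonzero configuration of finite support moves left by
  exactly one cell per step (\<open>leftmost_one_moves_left\<close>). Hence the column \<open>n\<close> cells to the left
  of it changes from 0 to 1 at time \<open>n\<close>, so the columns have no common time
  after which all of them far enough to the left are constant.
\<close>

lemma column_Suc:
  "column x i (Suc t) = column x (i - 1) t + (column x i t OR column x (i + 1) t)"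
  by (simp add: column_def rule30_def)

lemma column_left:
  "column x (i - 1) t = column x i (Suc t) + (column x i t OR column x (i + 1) t)"
  by (cases "column x (i - 1) t"; cases "column x i t OR column x (i + 1) t")
    (simp_all only: column_Suc, simp_all)

lemma columns_constant_left:
  assumes i: "\<And>t. t \<ge> T \<Longrightarrow> column x i (Suc t) = column x i t"
    and i1: "\<And>t. t \<ge> T \<Longrightarrow> column x (i + 1) (Suc t) = column x (i + 1) t"
    and "j \<le> i" "t \<ge> T"
  shows "column x j (Suc t) = column x j t"
proof -
  \<comment> \<open>The recurrence has order two, so the induction carries a pair of adjacent columns.\<close>
  have "\<forall>t\<ge>T. column x j (Suc t) = column x j t
      \<and> column x (j + 1) (Suc t) = column x (j + 1) t"
    using \<open>j \<le> i\<close>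
  proof (induction j rule: int_le_induct)
    case base
    then show ?case using i i1 by simp
  next
    case (step j)
    then show ?case by (simp add: column_left)
  qed
  then show ?thesis using \<open>t \<ge> T\<close> by blast
qed

text \<open>
  Beside a zero column the rule reads \<open>y \<mapsto> y OR z\<close>, so the values of the column to the right
  can only increase.
\<close>

lemma column_right_of_zero_constant:
  assumes zero: "\<And>t. t \<ge> T \<Longrightarrow> column x i t = 0"
  obtains S where "S \<ge> T" "\<And>t. t \<ge> S \<Longrightarrow> column x (i + 1) (Suc t) = column x (i + 1) t"
proof (cases "\<exists>S\<ge>T. column x (i + 1) S = 1")
  case True
  then obtain S where S: "S \<ge> T" "column x (i + 1) S = 1" by blast
  have one: "column x (i + 1) t = 1" if "t \<ge> S" for t
    using that
  proof (induction t rule: dec_induct)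
    case base
    then show ?case by (rule S(2))
  next
    case (step t)
    then show ?case using zero[of t] S(1) by (simp add: column_Suc)
  qed
  show ?thesis by (rule that[OF S(1)]) (simp add: one)
next
  case False
  then show ?thesis using that[of T] by simp
qed

lemma leftmost_one_moves_left:
  assumes "x L = 1" and "\<And>j. j < L \<Longrightarrow> x j = 0"
  shows "column x (L - int t) t = 1 \<and> (\<forall>j < L - int t. column x j t = 0)"
proof (induction t)
  case 0
  then show ?case using assms by (simp add: column_def)
next
  case (Suc t)
  \<comment> \<open>The new leftmost cell sees the neighbourhood \<open>0 0 1\<close>; all cells further left see \<open>0 0 0\<close>.\<close>
  then show ?case by (simp add: column_Suc algebra_simps)
qed

lemma finite_support_leftmost_one:
  assumes "finite_support x" "x \<noteq> zero_configuration"
  obtains L where "x L = 1" "\<And>j. j < L \<Longrightarrow> x j = 0"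
proof -
  let ?S = "{i. x i = 1}"
  have fin: "finite ?S" using assms(1) by (simp add: finite_support_def)
  have ne: "?S \<noteq> {}" using assms(2) by (auto simp: zero_configuration_def)
  show ?thesis
  proof (rule that[of "Min ?S"])
    show "x (Min ?S) = 1" using Min_in[OF fin ne] by simp
    show "x j = 0" if "j < Min ?S" for j
    proof (rule ccontr)
      assume "x j \<noteq> 0"
      then have "Min ?S \<le> j" using fin by simp
      with that show False by simp
    qed
  qed
qed

lemma no_column_eventually_zero:
  assumes "finite_support x" "x \<noteq> zero_configuration"
  shows "\<not> (\<forall>t\<ge>T. column x i t = 0)"
proof
  assume zero: "\<forall>t\<ge>T. column x i t = 0"
  obtain S where S: "S \<ge> T"
    and right: "\<And>t. t \<ge> S \<Longrightarrow> column x (i + 1) (Suc t) = column x (i + 1) t"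
    using column_right_of_zero_constant[of T x i] zero by blast
  obtain L where L: "x L = 1" "\<And>j. j < L \<Longrightarrow> x j = 0"
    using finite_support_leftmost_one[OF assms] by blast
  \<comment> \<open>A column that the leftmost 1 reaches only after time \<open>S\<close>, and that lies at or left of \<open>i\<close>.\<close>
  define n where "n = S + nat (L - i)"
  define j where "j = L - int (Suc n)"
  have "j \<le> i" "S \<le> n" by (auto simp: j_def n_def)
  then have "column x j (Suc n) = column x j n"
    using columns_constant_left[of S x i j n] zero S right by simp
  moreover have "column x j (Suc n) = 1"
    using leftmost_one_moves_left[of x L "Suc n"] L by (simp add: j_def)
  moreover have "column x j n = 0"
    using leftmost_one_moves_left[of x L n] L by (simp add: j_def)
  ultimately show False by simp
qed

lemma rule30_iterate_zero: "(rule30 ^^ t) zero_configuration = zero_configuration"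
  by (induction t) (simp_all add: rule30_def zero_configuration_def)

theorem corollary4:
  fixes x :: configuration
  assumes "finite_support x"
  shows "((\<forall>t::nat. (rule30 ^^ t) x 0 = 0) \<longleftrightarrow> x = zero_configuration) \<and>
    (x \<noteq> zero_configuration \<longrightarrow>
      \<not> (\<exists>(i::int) (T::nat). \<forall>t\<ge>T. column x i t = 0))"
proof -
  have "x = zero_configuration" if "\<forall>t. (rule30 ^^ t) x 0 = 0"
    using no_column_eventually_zero[OF assms, of 0 0] that by (auto simp: column_def)
  moreover have "(rule30 ^^ t) zero_configuration 0 = 0" for t
    by (simp only: rule30_iterate_zero) (simp add: zero_configuration_def)
  ultimately show ?thesis using no_column_eventually_zero[OF assms] by blast
qed

end
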